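(* For every graph $G$ on $n\ge 2$ vertices and $m$ edges, $\mathrm{box}(G)\le (15e+1)\sqrt{m\log n}$.
   Context: Graphs are finite and simple. A $d$-box is a Cartesian product $[x_1,y_1]\times\cdots\times[x_d,y_d]$ of $d$ closed intervals of the real line. The boxicity $\mathrm{box}(G)$ of a graph $G$ is the smallest integer $d\ge 1$ such that $G$ is the intersection graph of a collection of $d$-boxes, i.e. one can assign to each vertex $v$ a $d$-box $B_v$ such that two distinct vertices $u,v$ are adjacent if and only if $B_u\cap B_v\neq\emptyset$ (distinct vertices may be assigned the same box). Equivalently, it is the smallest $k$ such that $G=(V,E)$ is the intersection of $k$ interval graphs $G_i=(V,E_i)$, $1\le i\le k$, meaning $E=E_1\cap\cdots\cap E_k$. The logarithm is the natural logarithm and $e$ is its base.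
   Formalization: The graph is assumed to have at least one edge (m ≥ 1), since for m = 0 the bound is 0 while the boxicity of an edgeless graph is 1 by the convention d ≥ 1. *)

theory Defs
  imports Complex_Main "HOL-Library.FuncSet"
begin

definition simple_graph :: "'a set \<Rightarrow> 'a set set \<Rightarrow> bool" where
  "simple_graph V E \<longleftrightarrow> finite V \<and> E \<subseteq> {e. e \<subseteq> V \<and> card e = 2}"

text \<open>Points of \<open>d\<close>-dimensional space are the functions \<open>nat \<Rightarrow> real\<close> that are
  \<open>undefined\<close> outside \<open>{..<d}\<close>, so that \<open>d\<close> can be an ordinary variable.\<close>

definition is_box :: "nat \<Rightarrow> (nat \<Rightarrow> real) set \<Rightarrow> bool" where
  "is_box d B \<longleftrightarrow>
     (\<exists>x y. (\<forall>i<d. x i \<le> y i) \<and> B = (\<Pi>\<^sub>E i\<in>{..<d}. {x i..y i}))"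

definition box_representation ::
    "nat \<Rightarrow> 'a set \<Rightarrow> 'a set set \<Rightarrow> ('a \<Rightarrow> (nat \<Rightarrow> real) set) \<Rightarrow> bool" where
  "box_representation d V E B \<longleftrightarrow>
     (\<forall>v\<in>V. is_box d (B v)) \<and>
     (\<forall>u\<in>V. \<forall>v\<in>V. u \<noteq> v \<longrightarrow> ({u, v} \<in> E \<longleftrightarrow> B u \<inter> B v \<noteq> {}))"

definition boxicity :: "'a set \<Rightarrow> 'a set set \<Rightarrow> nat" where
  "boxicity V E = (LEAST d. d \<ge> 1 \<and> (\<exists>B. box_representation d V E B))"

text \<open>Since the dimension is at least 1, an edgeless graph has boxicity 1; an upper bound
  proportional to the square root of the number of edges therefore needs at least one edge.\<close>

lemma boxicity_edgeless:
  assumes "finite V"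
  shows "boxicity V {} = 1"
proof -
  obtain f :: "'a \<Rightarrow> nat" where f: "inj_on f V"
    using finite_imp_inj_to_nat_seg[OF assms] by blast
  define B where "B v = (\<Pi>\<^sub>E i\<in>{..<1::nat}. {real (f v)..real (f v)})" for v
  have "is_box 1 (B v)" for v
    unfolding is_box_def B_def
    by (rule exI[of _ "\<lambda>_. real (f v)"], rule exI[of _ "\<lambda>_. real (f v)"]) simp
  moreover have "B u \<inter> B v = {}" if "u \<in> V" "v \<in> V" "u \<noteq> v" for u v
  proof -
    have "f u \<noteq> f v"
      using f that by (auto dest: inj_onD)
    moreover have "g 0 = real (f w)" if "g \<in> B w" for g w
      using PiE_mem[OF that[unfolded B_def], of 0] by simp
    ultimately show ?thesis
      by (metis disjoint_iff of_nat_eq_iff)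
  qed
  ultimately have "box_representation 1 V {} B"
    by (auto simp: box_representation_def)
  then show ?thesis
    unfolding boxicity_def by (intro Least_equality) auto
qed

end

theory Submission
  imports Defs
begin

text \<open>
  A graph has boxicity at most \<open>k\<close> as soon as there are \<open>k\<close> interval models on its vertex set
  (\<open>k \<ge> 1\<close>), each of which makes all adjacent vertices overlap, such that every pair of
  non-adjacent vertices is disjoint in at least one of them (\<open>boxicity_le_card\<close>).  So the task is
  to separate all non-edges with few models.  Write \<open>L = ln n\<close> and \<open>s = sqrt (m L)\<close>, and let \<open>S\<close>
  be the set of vertices of degree greater than \<open>d\<close>; since the degrees sum to \<open>2 m\<close>, it has at
  most \<open>2 m / (d + 1)\<close> elements.

  A vertex \<open>x \<in> S\<close> costs one model: \<open>x\<close> is the point 1, its non-neighbours are the point 0, and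
  its neighbours are the interval from 0 to 1.  More generally, every vertex set \<open>A\<close> gives a model
  in which \<open>A\<close> sits at 1, the vertices outside the closed neighbourhood of \<open>A\<close> sit at 0, and the
  remaining ones are the interval from 0 to 1.  For non-adjacent vertices \<open>u, v\<close> of degree at most
  \<open>d\<close>, it separates \<open>u\<close> from \<open>v\<close> when \<open>A\<close> contains \<open>u\<close> but misses the closed neighbourhood of
  \<open>v\<close>.  If \<open>A\<close> contains each vertex independently with probability \<open>1 / q\<close>, where \<open>q = d + 2\<close>,
  this happens with probability at least \<open>(1 / q) (1 - 1 / q) ^ (q - 1) \<ge> 1 / (e q)\<close>
  (\<open>random_set_separates\<close>).  Choosing such sets greedily, about \<open>2 e q L\<close> of them separate all
  of the at most \<open>n ^ 2\<close> ordered pairs (\<open>exists_small_cover\<close>, \<open>exists_separating_sets\<close>).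

  With \<open>d\<close> the integer part of \<open>sqrt (m / L)\<close> the two contributions are at most \<open>2 s\<close> and
  \<open>2 e s + 4 e L + 1\<close>, which is of order \<open>s\<close> provided that \<open>L \<le> m\<close>, since then \<open>L \<le> s\<close>.  If
  \<open>m < L\<close>, then \<open>d = 0\<close> is used: \<open>S\<close> consists of the at most \<open>2 m \<le> 2 s\<close> non-isolated vertices, and
  a single model separates all the isolated ones by placing them at distinct points
  (\<open>boxicity_le_non_isolated\<close>).
\<close>

section \<open>Boxicity through interval models\<close>

definition interval_model :: "'a set \<Rightarrow> 'a set set \<Rightarrow> ('a \<Rightarrow> real) \<times> ('a \<Rightarrow> real) \<Rightarrow> bool" where
  "interval_model V E c \<longleftrightarrow> (\<forall>v\<in>V. fst c v \<le> snd c v) \<and>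
     (\<forall>u\<in>V. \<forall>v\<in>V. {u, v} \<in> E \<longrightarrow> fst c u \<le> snd c v)"

definition separated_by :: "('a \<Rightarrow> real) \<times> ('a \<Rightarrow> real) \<Rightarrow> 'a \<Rightarrow> 'a \<Rightarrow> bool" where
  "separated_by c u v \<longleftrightarrow> snd c u < fst c v \<or> snd c v < fst c u"

text \<open>The models serve as the coordinates of the boxes: two boxes are disjoint exactly when they
  are disjoint in some coordinate.\<close>

lemma boxicity_le_card:
  assumes fin: "finite C" and ne: "C \<noteq> {}"
    and model: "\<And>c. c \<in> C \<Longrightarrow> interval_model V E c"
    and sep: "\<And>u v. \<lbrakk>u \<in> V; v \<in> V; u \<noteq> v; {u, v} \<notin> E\<rbrakk> \<Longrightarrow> \<exists>c\<in>C. separated_by c u v"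
  shows "boxicity V E \<le> card C"
proof -
  define k where "k = card C"
  obtain h where h: "bij_betw h {..<k} C"
    using ex_bij_betw_nat_finite[OF fin] by (auto simp: k_def atLeast0LessThan)
  have hC: "h i \<in> C" if "i < k" for i
    using h that by (auto simp: bij_betw_def)
  define B where "B v = (\<Pi>\<^sub>E i\<in>{..<k}. {fst (h i) v..snd (h i) v})" for v
  have box: "is_box k (B v)" if "v \<in> V" for v
    unfolding is_box_def B_def
    by (rule exI[of _ "\<lambda>i. fst (h i) v"], rule exI[of _ "\<lambda>i. snd (h i) v"])
      (use model[OF hC] that in \<open>auto simp: interval_model_def\<close>)
  have "{u, v} \<in> E \<longleftrightarrow> B u \<inter> B v \<noteq> {}" if uv: "u \<in> V" "v \<in> V" "u \<noteq> v" for u v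
  proof
    assume e: "{u, v} \<in> E"
    then have e': "{v, u} \<in> E" by (simp add: insert_commute)
    define g where "g = (\<lambda>i\<in>{..<k}. max (fst (h i) u) (fst (h i) v))"
    have "g \<in> B u \<inter> B v"
      using model[OF hC] uv e e' by (auto simp: B_def g_def interval_model_def)
    then show "B u \<inter> B v \<noteq> {}" by blast
  next
    assume "B u \<inter> B v \<noteq> {}"
    then obtain g where g: "g \<in> B u" "g \<in> B v" by blast
    show "{u, v} \<in> E"
    proof (rule ccontr)
      assume "{u, v} \<notin> E"
      then obtain c where c: "c \<in> C" "separated_by c u v" using sep uv by blast
      then obtain i where i: "i < k" "c = h i"
        using h by (auto simp: bij_betw_def)
      have "g i \<in> {fst c u..snd c u}" "g i \<in> {fst c v..snd c v}"
        using PiE_mem[OF g(1)[unfolded B_def], of i] PiE_mem[OF g(2)[unfolded B_def], of i] i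
        by auto
      with c(2) show False by (auto simp: separated_by_def)
    qed
  qed
  with box have "box_representation k V E B"
    by (simp add: box_representation_def)
  moreover have "k \<ge> 1"
    using fin ne by (simp add: k_def Suc_le_eq card_gt_0_iff)
  ultimately show ?thesis
    unfolding boxicity_def k_def[symmetric] by (intro Least_le) blast
qed

definition cut_model :: "'a set \<Rightarrow> 'a set \<Rightarrow> ('a \<Rightarrow> real) \<times> ('a \<Rightarrow> real)" where
  "cut_model A B = ((\<lambda>v. if v \<in> A then 1 else 0), (\<lambda>v. if v \<in> B then 0 else 1))"

lemma interval_model_cut_model:
  assumes "A \<inter> B = {}" "\<And>u v. \<lbrakk>u \<in> A; v \<in> B\<rbrakk> \<Longrightarrow> {u, v} \<notin> E"
  shows "interval_model V E (cut_model A B)"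
  using assms by (auto simp: interval_model_def cut_model_def)

lemma separated_by_cut_model:
  assumes "u \<in> A" "v \<in> B"
  shows "separated_by (cut_model A B) u v" "separated_by (cut_model A B) v u"
  using assms by (auto simp: separated_by_def cut_model_def)

text \<open>Vertices of an independent set become distinct points, while all other vertices receive an
  interval that covers every one of these points.\<close>

lemma independent_set_model:
  assumes "finite W" and indep: "\<And>u v. \<lbrakk>u \<in> W; v \<in> W\<rbrakk> \<Longrightarrow> {u, v} \<notin> E"
  obtains c where "interval_model V E c"
    "\<And>u v. \<lbrakk>u \<in> W; v \<in> W; u \<noteq> v\<rbrakk> \<Longrightarrow> separated_by c u v"
proof -
  obtain f :: "'a \<Rightarrow> nat" and n where f: "inj_on f W" "f ` W = {i. i < n}"
    using finite_imp_inj_to_nat_seg[OF assms(1)] by metis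
  have fn: "f v \<le> n" if "v \<in> W" for v
    using f(2) that by (metis imageI less_imp_le mem_Collect_eq)
  define c :: "('a \<Rightarrow> real) \<times> ('a \<Rightarrow> real)" where
    "c = ((\<lambda>v. if v \<in> W then f v else 0), (\<lambda>v. if v \<in> W then f v else n))"
  have "interval_model V E c"
    using fn indep by (auto simp: interval_model_def c_def)
  moreover have "separated_by c u v" if "u \<in> W" "v \<in> W" "u \<noteq> v" for u v
  proof -
    have "f u \<noteq> f v" using f(1) that by (auto dest: inj_onD)
    then show ?thesis using that by (auto simp: separated_by_def c_def)
  qed
  ultimately show thesis by (rule that)
qed

section \<open>Vertices of large degree\<close>

lemma card_large_degree:
  assumes "simple_graph V E"
  shows "card {v \<in> V. card {e \<in> E. v \<in> e} > d} * Suc d \<le> 2 * card E"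
proof -
  have fV: "finite V" and E: "E \<subseteq> {e. e \<subseteq> V \<and> card e = 2}"
    using assms by (auto simp: simple_graph_def)
  have fE: "finite E"
    using fV E by (intro finite_subset[of E "Pow V"]) auto
  let ?S = "{v \<in> V. card {e \<in> E. v \<in> e} > d}"
  have "card {v \<in> V. v \<in> e} = 2" if "e \<in> E" for e
  proof -
    have "{v \<in> V. v \<in> e} = e" using E that by auto
    then show ?thesis using E that by auto
  qed
  then have total: "(\<Sum>v\<in>V. card {e \<in> E. v \<in> e}) = 2 * card E"
    by (intro sum_multicount[OF fV fE]) blast
  have "card ?S * Suc d = (\<Sum>v\<in>?S. Suc d)" by simp
  also have "\<dots> \<le> (\<Sum>v\<in>?S. card {e \<in> E. v \<in> e})" by (intro sum_mono) auto
  also have "\<dots> \<le> (\<Sum>v\<in>V. card {e \<in> E. v \<in> e})" using fV by (intro sum_mono2) auto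
  finally show ?thesis using total by simp
qed

lemma card_neighbours_le_degree:
  assumes "finite E"
  shows "card {w. {v, w} \<in> E} \<le> card {e \<in> E. v \<in> e}"
proof (rule card_inj_on_le[where f = "\<lambda>w. {v, w}"])
  show "inj_on (\<lambda>w. {v, w}) {w. {v, w} \<in> E}"
    by (auto simp: inj_on_def doubleton_eq_iff)
qed (use assms in auto)

section \<open>Separating vertices of small degree\<close>

text \<open>The greedy covering bound: by averaging over \<open>F\<close>, some member covers at least the fraction
  \<open>\<epsilon>\<close> of what is still uncovered, so that the uncovered part shrinks by the factor \<open>1 - \<epsilon>\<close> in each
  step.\<close>

lemma greedy_cover:
  fixes \<epsilon> :: real
  assumes fP: "finite P" and fF: "finite F" and ne: "F \<noteq> {}" and eps: "\<epsilon> \<le> 1"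
    and dense: "\<And>p. p \<in> P \<Longrightarrow> \<epsilon> * card F \<le> card {f \<in> F. R f p}"
  shows "\<exists>C \<subseteq> F. card C \<le> k \<and> card {p \<in> P. \<forall>f\<in>C. \<not> R f p} \<le> card P * (1 - \<epsilon>) ^ k"
proof (induction k)
  case 0
  show ?case by (intro exI[of _ "{}"]) simp
next
  case (Suc k)
  then obtain C where C: "C \<subseteq> F" "card C \<le> k"
    and U_le: "card {p \<in> P. \<forall>f\<in>C. \<not> R f p} \<le> card P * (1 - \<epsilon>) ^ k" by blast
  define U where "U = {p \<in> P. \<forall>f\<in>C. \<not> R f p}"
  have fU: "finite U" using fP by (simp add: U_def)
  have "\<exists>f\<in>F. \<epsilon> * card U \<le> card {p \<in> U. R f p}"
  proof (rule ccontr)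
    assume "\<not> ?thesis"
    then have less: "card {p \<in> U. R f p} < \<epsilon> * card U" if "f \<in> F" for f
      using that by force
    have "(\<Sum>f\<in>F. real (card {p \<in> U. R f p})) < (\<Sum>f\<in>F. \<epsilon> * card U)"
      using fF ne less by (intro sum_strict_mono)
    also have "\<dots> = (\<Sum>p\<in>U. \<epsilon> * card F)" by simp
    also have "\<dots> \<le> (\<Sum>p\<in>U. real (card {f \<in> F. R f p}))"
      by (intro sum_mono dense) (simp add: U_def)
    also have "\<dots> = (\<Sum>f\<in>F. real (card {p \<in> U. R f p}))"
      using sum.swap_restrict[OF fU fF, of "\<lambda>_ _. 1::real" "\<lambda>p f. R f p"] by simp
    finally show False by simp
  qed
  then obtain f where f: "f \<in> F" "\<epsilon> * card U \<le> card {p \<in> U. R f p}" by blast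
  have "{p \<in> P. \<forall>g\<in>insert f C. \<not> R g p} = U - {p \<in> U. R f p}"
    by (auto simp: U_def)
  then have "real (card {p \<in> P. \<forall>g\<in>insert f C. \<not> R g p}) = card U - card {p \<in> U. R f p}"
    using fU by (simp add: card_Diff_subset)
  also have "\<dots> \<le> (1 - \<epsilon>) * card U"
  proof -
    have "card {p \<in> U. R f p} \<le> card U" using fU by (intro card_mono) auto
    then show ?thesis using f(2) by (simp add: of_nat_diff algebra_simps)
  qed
  also have "\<dots> \<le> (1 - \<epsilon>) * (card P * (1 - \<epsilon>) ^ k)"
    using U_le eps by (intro mult_left_mono) (auto simp: U_def)
  finally have "card {p \<in> P. \<forall>g\<in>insert f C. \<not> R g p} \<le> card P * (1 - \<epsilon>) ^ Suc k"
    by (simp add: algebra_simps)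
  moreover have "card (insert f C) \<le> Suc k"
    using C card_insert_le_m1[of "Suc k" C f] by simp
  moreover have "insert f C \<subseteq> F" using C f by blast
  ultimately show ?case by blast
qed

lemma exists_small_cover:
  fixes \<epsilon> :: real
  assumes fP: "finite P" and fF: "finite F" and ne: "F \<noteq> {}" and eps: "\<epsilon> \<le> 1"
    and dense: "\<And>p. p \<in> P \<Longrightarrow> \<epsilon> * card F \<le> card {f \<in> F. R f p}"
    and small: "card P * (1 - \<epsilon>) ^ k < 1"
  obtains C where "C \<subseteq> F" "card C \<le> k" "\<And>p. p \<in> P \<Longrightarrow> \<exists>f\<in>C. R f p"
proof -
  obtain C where C: "C \<subseteq> F" "card C \<le> k"
    and le: "card {p \<in> P. \<forall>f\<in>C. \<not> R f p} \<le> card P * (1 - \<epsilon>) ^ k"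
    using greedy_cover[where R = R and k = k, OF fP fF ne eps dense] by blast
  have "card {p \<in> P. \<forall>f\<in>C. \<not> R f p} = 0"
    using le small by linarith
  moreover have "finite {p \<in> P. \<forall>f\<in>C. \<not> R f p}" using fP by simp
  ultimately have "{p \<in> P. \<forall>f\<in>C. \<not> R f p} = {}" using card_0_eq by blast
  then have "\<exists>f\<in>C. R f p" if "p \<in> P" for p using that by blast
  with C show thesis by (rule that)
qed

lemma one_minus_inverse_power_ge:
  assumes "q \<ge> (2::nat)"
  shows "(1 - 1 / real q) ^ (q - 1) \<ge> exp (-1)"
proof -
  obtain r where q: "q = Suc r" and r: "r \<ge> 1" using assms by (cases q) auto
  have "(1 + 1 / real r) ^ r \<le> exp (1 / real r) ^ r"
    by (intro power_mono exp_ge_add_one_self) auto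
  also have "\<dots> = exp 1"
    using r by (simp add: exp_of_nat_mult[symmetric])
  finally have "inverse (exp 1) \<le> inverse ((1 + 1 / real r) ^ r)"
    using r by (intro le_imp_inverse_le) (auto intro!: zero_less_power add_pos_nonneg)
  also have "\<dots> = (1 - 1 / real q) ^ (q - 1)"
    using r by (simp add: q power_inverse[symmetric] field_simps)
  finally show ?thesis by (simp add: exp_minus)
qed

text \<open>The probability space consists of the maps \<open>f\<close> from \<open>W\<close> to \<open>q\<close> values, and the random set
  is the preimage of 0, so that it contains each vertex independently with probability \<open>1 / q\<close>.
  The choice \<open>card N \<le> q - 1\<close> balances the two requirements: \<open>u\<close> is chosen with probability
  \<open>1 / q\<close>, and still with constant probability the whole of \<open>N\<close> is missed.\<close>

lemma random_set_separates:
  assumes fW: "finite W" and u: "u \<in> W" "u \<notin> N" and N: "N \<subseteq> W" "card N \<le> q - 1"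
    and q: "q \<ge> (2::nat)"
  shows "1 / (exp 1 * q) * card (W \<rightarrow>\<^sub>E {..<q})
           \<le> card {f \<in> W \<rightarrow>\<^sub>E {..<q}. f u = 0 \<and> (\<forall>w\<in>N. f w \<noteq> 0)}"
proof -
  have fN: "finite N" using N(1) fW by (rule finite_subset)
  define T where "T w = (if w = u then {0} else if w \<in> N then {1..<q} else {..<q})" for w
  have T: "{f \<in> W \<rightarrow>\<^sub>E {..<q}. f u = 0 \<and> (\<forall>w\<in>N. f w \<noteq> 0)} = PiE W T"
    (is "?L = _")
  proof
    show "?L \<subseteq> PiE W T"
      by (auto simp: T_def PiE_iff Suc_le_eq extensional_def)
    show "PiE W T \<subseteq> ?L"
    proof
      fix f assume f: "f \<in> PiE W T"
      have T_sub: "T w \<subseteq> {..<q}" for w using q by (auto simp: T_def)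
      have "f \<in> W \<rightarrow>\<^sub>E {..<q}" using f T_sub by (meson PiE_mono subsetD)
      moreover have "f u = 0" using PiE_mem[OF f u(1)] by (simp add: T_def)
      moreover have "f w \<noteq> 0" if "w \<in> N" for w
        using PiE_mem[OF f, of w] that N u by (auto simp: T_def split: if_splits)
      ultimately show "f \<in> ?L" by blast
    qed
  qed
  have "exp (-1) / q \<le> (1 / q) * (1 - 1 / real q) ^ (q - 1)"
    using one_minus_inverse_power_ge[OF q] q by (simp add: divide_right_mono)
  also have "\<dots> \<le> (1 / q) * (1 - 1 / real q) ^ card N"
    using N(2) q by (intro mult_left_mono power_decreasing) auto
  finally have "exp (-1) / q * real q ^ card W
      \<le> ((1 / q) * (1 - 1 / real q) ^ card N) * real q ^ card W"
    by (intro mult_right_mono) auto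
  also have "\<dots> = real (card (PiE W T))"
  proof -
    have "real (card (PiE W T)) = (\<Prod>w\<in>W. real (card (T w)))"
      using fW by (simp add: card_PiE)
    also have "\<dots> = (\<Prod>w\<in>W. real q *
        ((if w = u then 1 / real q else 1) * (if w \<in> N then 1 - 1 / real q else 1)))"
      using u q by (intro prod.cong) (auto simp: T_def of_nat_diff field_simps)
    also have "\<dots> = real q ^ card W * ((1 / q) * (1 - 1 / real q) ^ card (W \<inter> N))"
      using fW u by (simp add: prod.distrib prod.delta prod.If_cases Int_def)
    also have "W \<inter> N = N" using N by blast
    finally show ?thesis by simp
  qed
  finally show ?thesis
    unfolding T using fW by (simp add: card_PiE exp_minus field_simps)
qed

lemma exists_separating_sets:
  assumes fW: "finite W" and n: "card W \<le> n" "n \<ge> 2" and q: "q \<ge> (2::nat)"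
    and N: "\<And>v. v \<in> W \<Longrightarrow> N v \<subseteq> W" "\<And>v. v \<in> W \<Longrightarrow> card (N v) \<le> q - 1"
  obtains \<A> where "\<A> \<subseteq> Pow W" "real (card \<A>) \<le> 2 * exp 1 * q * ln n + 1"
    "\<And>u v. \<lbrakk>u \<in> W; v \<in> W; u \<notin> N v\<rbrakk> \<Longrightarrow> \<exists>A\<in>\<A>. u \<in> A \<and> A \<inter> N v = {}"
proof -
  define F where "F = W \<rightarrow>\<^sub>E {..<q}"
  define P where "P = {(u, v). u \<in> W \<and> v \<in> W \<and> u \<notin> N v}"
  define R where "R f p \<longleftrightarrow> f (fst p) = 0 \<and> (\<forall>w\<in>N (snd p). f w \<noteq> 0)"
    for f :: "'a \<Rightarrow> nat" and p
  define \<epsilon> where "\<epsilon> = 1 / (exp 1 * real q)"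
  define k where "k = nat \<lfloor>2 * exp 1 * q * ln n\<rfloor> + 1"
  have ln0: "ln (real n) \<ge> 0" using n by simp
  have k: "2 * exp 1 * q * ln n < k" "k \<le> 2 * exp 1 * q * ln n + 1"
  proof -
    have "0 \<le> 2 * exp 1 * q * ln n" using ln0 by simp
    then show "2 * exp 1 * q * ln n < k" "k \<le> 2 * exp 1 * q * ln n + 1"
      unfolding k_def by linarith+
  qed
  have e1: "exp (1::real) \<ge> 1" by simp
  have eps0: "\<epsilon> > 0" using q by (simp add: \<epsilon>_def)
  have eps: "\<epsilon> \<le> 1"
    using mult_mono[OF e1, of 1 "real q"] q by (simp add: \<epsilon>_def)
  have P_sub: "P \<subseteq> W \<times> W" by (auto simp: P_def)
  then have fP: "finite P" using fW by (meson finite_SigmaI finite_subset)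
  have "card P \<le> card W * card W"
    using card_mono[OF _ P_sub] fW by (simp add: card_cartesian_product)
  then have "card P \<le> n\<^sup>2"
    using n mult_le_mono[of "card W" n "card W" n] by (simp add: power2_eq_square)
  then have card_P: "real (card P) \<le> (real n)\<^sup>2"
    by (metis of_nat_le_iff of_nat_power)
  have "2 * ln n < \<epsilon> * k"
    using k(1) q by (simp add: \<epsilon>_def field_simps)
  then have "exp (- (\<epsilon> * k)) < exp (- (2 * ln n))" by simp
  also have "\<dots> = 1 / (real n)\<^sup>2"
    using n exp_of_nat_mult[of 2 "ln (real n)"] by (simp add: exp_minus inverse_eq_divide)
  finally have decay: "exp (- (\<epsilon> * k)) < 1 / (real n)\<^sup>2" .
  have "(1 - \<epsilon>) ^ k \<le> exp (- \<epsilon>) ^ k"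
    using eps exp_ge_add_one_self[of "- \<epsilon>"] by (intro power_mono) auto
  also have "\<dots> = exp (- (\<epsilon> * k))"
    by (simp add: exp_of_nat_mult[symmetric] mult.commute)
  finally have "card P * (1 - \<epsilon>) ^ k \<le> (real n)\<^sup>2 * exp (- (\<epsilon> * k))"
    using card_P eps by (intro mult_mono) auto
  also have "\<dots> < 1" using decay n by (simp add: field_simps)
  finally have small: "card P * (1 - \<epsilon>) ^ k < 1" .
  have fF: "finite F" using fW by (simp add: F_def finite_PiE)
  have not_empty: "{..<q} \<noteq> {}" using q by (simp add: lessThan_empty_iff)
  have neF: "F \<noteq> {}" using q not_empty by (auto simp: F_def PiE_eq_empty_iff)
  have dense: "\<epsilon> * card F \<le> card {f \<in> F. R f p}" if "p \<in> P" for p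
    using random_set_separates[OF fW, of "fst p" "N (snd p)" q] that N q
    by (auto simp: P_def R_def F_def \<epsilon>_def)
  obtain C where C: "C \<subseteq> F" "card C \<le> k" "\<And>p. p \<in> P \<Longrightarrow> \<exists>f\<in>C. R f p"
    using exists_small_cover[where R = R, OF fP fF neF eps dense small] by blast
  have fC: "finite C" using C fF finite_subset by blast
  show thesis
  proof
    show "(\<lambda>f. {w \<in> W. f w = 0}) ` C \<subseteq> Pow W" by auto
    have "card ((\<lambda>f. {w \<in> W. f w = 0}) ` C) \<le> k"
      using card_image_le[OF fC] C(2) le_trans by blast
    then show "real (card ((\<lambda>f. {w \<in> W. f w = 0}) ` C)) \<le> 2 * exp 1 * q * ln n + 1"
      using k(2) by linarith
    fix u v assume uv: "u \<in> W" "v \<in> W" "u \<notin> N v"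
    then obtain f where "f \<in> C" "R f (u, v)" using C(3)[of "(u, v)"] by (auto simp: P_def)
    then show "\<exists>A\<in>(\<lambda>f. {w \<in> W. f w = 0}) ` C. u \<in> A \<and> A \<inter> N v = {}"
      using uv by (auto simp: R_def intro!: bexI[of _ f])
  qed
qed

section \<open>The bound\<close>

text \<open>Removing a vertex set \<open>S\<close> lowers the boxicity by at most \<open>card S\<close>: each vertex of \<open>S\<close> is
  separated from all its non-neighbours by one model.  The models for the remaining vertices have
  to be models of the whole graph, hence the form of the assumptions on \<open>C\<close>.\<close>

lemma boxicity_le_card_add:
  assumes fS: "finite S" and fC: "finite C" and ne: "C \<noteq> {}"
    and model: "\<And>c. c \<in> C \<Longrightarrow> interval_model V E c"
    and sep: "\<And>u v. \<lbrakk>u \<in> V - S; v \<in> V - S; u \<noteq> v; {u, v} \<notin> E\<rbrakk>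
                \<Longrightarrow> \<exists>c\<in>C. separated_by c u v"
  shows "boxicity V E \<le> card S + card C"
proof -
  define D where "D = (\<lambda>s. cut_model {s} {w. w \<noteq> s \<and> {s, w} \<notin> E}) ` S"
  have D_model: "interval_model V E c" if "c \<in> D" for c
    using that by (auto simp: D_def intro!: interval_model_cut_model)
  have D_sep: "(\<exists>c\<in>D. separated_by c s w) \<and> (\<exists>c\<in>D. separated_by c w s)"
    if "s \<in> S" "w \<noteq> s" "{s, w} \<notin> E" for s w
    using that separated_by_cut_model[of s "{s}" w "{w. w \<noteq> s \<and> {s, w} \<notin> E}"]
    by (auto simp: D_def)
  have "boxicity V E \<le> card (D \<union> C)"
  proof (rule boxicity_le_card)
    show "finite (D \<union> C)" using fS fC by (simp add: D_def)
    show "D \<union> C \<noteq> {}" using ne by simp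
    show "interval_model V E c" if "c \<in> D \<union> C" for c
      using that D_model model by blast
    fix u v assume uv: "u \<in> V" "v \<in> V" "u \<noteq> v" "{u, v} \<notin> E"
    then have "{v, u} \<notin> E" by (simp add: insert_commute)
    with uv show "\<exists>c\<in>D \<union> C. separated_by c u v"
      using D_sep[of u v] D_sep[of v u] sep[of u v] by blast
  qed
  also have "\<dots> \<le> card D + card C" by (rule card_Un_le)
  also have "\<dots> \<le> card S + card C"
    using card_image_le[OF fS] by (simp add: D_def)
  finally show ?thesis .
qed

text \<open>The random sets are chosen among the vertices \<open>W\<close> of degree at most \<open>d\<close>, and in their models
  every other vertex is the interval from 0 to 1, because only the non-edges inside \<open>W\<close> remain to
  be separated.\<close>

lemma boxicity_le_large_degree_add:
  assumes G: "simple_graph V E" and n: "card V = n" "n \<ge> 2"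
  shows "boxicity V E \<le>
    card {v \<in> V. card {e \<in> E. v \<in> e} > d} + (2 * exp 1 * (real d + 2) * ln n + 1)"
proof -
  have fV: "finite V" and E: "E \<subseteq> {e. e \<subseteq> V \<and> card e = 2}"
    using G by (auto simp: simple_graph_def)
  have fE: "finite E"
    using fV E by (intro finite_subset[of E "Pow V"]) auto
  define S where "S = {v \<in> V. card {e \<in> E. v \<in> e} > d}"
  define W where "W = V - S"
  have fW: "finite W" "card W \<le> n" and fS: "finite S"
    using fV n by (auto simp: W_def S_def intro!: card_mono)
  define N where "N v = insert v {w. {v, w} \<in> E} \<inter> W" for v
  have cardN: "card (N v) \<le> (d + 2) - 1" if "v \<in> W" for v
  proof -
    have "{w. {v, w} \<in> E} \<subseteq> V" using E by auto
    then have fin: "finite {w. {v, w} \<in> E}" using fV by (rule finite_subset)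
    have "card (N v) \<le> card (insert v {w. {v, w} \<in> E})"
      using fin by (intro card_mono) (auto simp: N_def)
    also have "\<dots> \<le> Suc (card {w. {v, w} \<in> E})"
      by (simp add: fin card_insert_if)
    also have "\<dots> \<le> Suc d"
      using card_neighbours_le_degree[OF fE, of v] that
      by (auto simp: W_def S_def not_less)
    finally show ?thesis by simp
  qed
  obtain \<A> where \<A>: "\<A> \<subseteq> Pow W" "real (card \<A>) \<le> 2 * exp 1 * real (d + 2) * ln n + 1"
    and \<A>_sep: "\<And>u v. \<lbrakk>u \<in> W; v \<in> W; u \<notin> N v\<rbrakk> \<Longrightarrow> \<exists>A\<in>\<A>. u \<in> A \<and> A \<inter> N v = {}"
    using exists_separating_sets[OF fW n(2), of "d + 2" N] cardN by (auto simp: N_def)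
  have f\<A>: "finite \<A>" using \<A>(1) fW by (meson finite_Pow_iff finite_subset)
  show ?thesis
  proof (cases "\<A> = {}")
    case False
    define cut where "cut A = cut_model A {v \<in> W. A \<inter> N v = {}}" for A
    have "boxicity V E \<le> card S + card (cut ` \<A>)"
    proof (rule boxicity_le_card_add[OF fS])
      show "finite (cut ` \<A>)" "cut ` \<A> \<noteq> {}" using f\<A> False by auto
      show "interval_model V E c" if "c \<in> cut ` \<A>" for c
      proof -
        obtain A where A: "A \<in> \<A>" "c = cut A" using \<open>c \<in> cut ` \<A>\<close> by blast
        have "{u, v} \<notin> E" if "u \<in> A" "v \<in> W" "A \<inter> N v = {}" for u v
        proof
          assume "{u, v} \<in> E"
          then have "u \<in> N v"
            using A(1) \<A>(1) that(1) by (auto simp: N_def insert_commute)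
          with that show False by blast
        qed
        then show ?thesis
          unfolding A(2) cut_def by (intro interval_model_cut_model) (auto simp: N_def)
      qed
      show "\<exists>c\<in>cut ` \<A>. separated_by c u v"
        if uv: "u \<in> V - S" "v \<in> V - S" "u \<noteq> v" "{u, v} \<notin> E" for u v
      proof -
        obtain A where "A \<in> \<A>" "u \<in> A" "A \<inter> N v = {}"
          using uv \<A>_sep[of u v] by (auto simp: N_def W_def insert_commute)
        then show ?thesis
          using uv by (auto simp: cut_def W_def intro!: bexI[of _ A] separated_by_cut_model(1))
      qed
    qed
    also have "\<dots> \<le> card S + card \<A>" using card_image_le[OF f\<A>] by simp
    finally have "real (boxicity V E) \<le> card S + real (card \<A>)" by linarith
    then show ?thesis using \<A>(2) by (simp add: S_def algebra_simps)
  next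
    case True
    \<comment> \<open>Nothing is left to separate, but the dimension of a box representation has to be
      positive.\<close>
    have "boxicity V E \<le> card S + card {cut_model {} ({} :: 'a set)}"
      using \<A>_sep True
      by (intro boxicity_le_card_add[OF fS])
        (auto simp: N_def W_def insert_commute intro!: interval_model_cut_model)
    then have "real (boxicity V E) \<le> card S + 1" by simp
    moreover have "2 * exp 1 * (real d + 2) * ln n \<ge> 0" using n by simp
    ultimately show ?thesis unfolding S_def by linarith
  qed
qed

lemma boxicity_le_non_isolated:
  assumes "simple_graph V E"
  shows "boxicity V E \<le> card {v \<in> V. card {e \<in> E. v \<in> e} > 0} + 1"
proof -
  define S where "S = {v \<in> V. card {e \<in> E. v \<in> e} > 0}"
  have fV: "finite V" and E: "E \<subseteq> {e. e \<subseteq> V \<and> card e = 2}"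
    using assms by (auto simp: simple_graph_def)
  have fE: "finite E"
    using fV E by (intro finite_subset[of E "Pow V"]) auto
  have indep: "{u, v} \<notin> E" if "u \<in> V - S" for u v
    using that fE by (auto simp: S_def)
  obtain c where "interval_model V E c"
    "\<And>u v. \<lbrakk>u \<in> V - S; v \<in> V - S; u \<noteq> v\<rbrakk> \<Longrightarrow> separated_by c u v"
    using independent_set_model[of "V - S" E V] fV indep by blast
  then have "boxicity V E \<le> card S + card {c}"
    using fV by (intro boxicity_le_card_add) (auto simp: S_def)
  then show ?thesis by (simp add: S_def)
qed

theorem theorem4:
  fixes V :: "'a set" and E :: "'a set set" and n m :: nat
  assumes "simple_graph V E"
    and "card V = n" and "n \<ge> 2"
    and "card E = m" and "m \<ge> 1"
  shows "real (boxicity V E) \<le> (15 * exp 1 + 1) * sqrt (real m * ln (real n))"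
proof -
  define L where "L = ln (real n)"
  define s where "s = sqrt (real m * L)"
  define e where "e = exp (1::real)"
  have e: "e \<ge> 1" by (simp add: e_def)
  have L: "L \<ge> 1 / 2"
  proof -
    have "ln (1 / real n) \<le> 1 / real n - 1" using assms(3) by (intro ln_le_minus_one) simp
    moreover have "1 / real n \<le> 1 / 2" using assms(3) by (simp add: field_simps)
    moreover have "ln (1 / real n) = - L" using assms(3) by (simp add: L_def ln_div)
    ultimately show ?thesis by linarith
  qed
  have s_sq: "s * s = m * L" using L by (simp add: s_def)
  have s: "s \<ge> 1 / 2"
  proof -
    have "1 / 4 \<le> m * L" using L assms(5) mult_mono[of 1 "real m" "1/2" L] by simp
    then show ?thesis unfolding s_def by (intro real_le_rsqrt) (simp add: power2_eq_square)
  qed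
  have es: "s \<le> e * s" using e s by simp
  have "boxicity V E \<le> (15 * e + 1) * s"
  proof (cases "L \<le> m")
    case True
    \<comment> \<open>Since \<open>s / L = sqrt (m / L)\<close>, both \<open>m / (d + 1)\<close> and \<open>d L\<close> are of order \<open>s\<close>.\<close>
    define d where "d = nat \<lfloor>s / L\<rfloor>"
    have sL: "s / L \<ge> 0" using s L by simp
    have d: "d \<le> s / L" "s / L < d + 1" using sL unfolding d_def by linarith+
    have Ls: "L \<le> s"
      unfolding s_def using True L by (intro real_le_rsqrt) (simp add: power2_eq_square)
    have S: "card {v \<in> V. card {e \<in> E. v \<in> e} > d} \<le> 2 * s" (is "real ?c \<le> _")
    proof -
      have "real ?c * s \<le> real ?c * ((d + 1) * L)"
        using d(2) L by (intro mult_left_mono) (auto simp: field_simps)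
      also have "\<dots> = real (?c * Suc d) * L" by (simp add: algebra_simps)
      also have "\<dots> \<le> real (2 * m) * L"
        using card_large_degree[OF assms(1), of d] assms(4) L
        by (intro mult_right_mono of_nat_mono) auto
      also have "\<dots> = (2 * s) * s" using s_sq by simp
      finally show ?thesis using s by simp
    qed
    have "(d + 2) * L \<le> 3 * s"
      using d(1) L Ls by (simp add: field_simps)
    then have "2 * e * ((d + 2) * L) \<le> 2 * e * (3 * s)"
      using e by (intro mult_left_mono) auto
    then have "2 * e * (real d + 2) * L \<le> 6 * (e * s)" by (simp add: algebra_simps)
    then have "boxicity V E \<le> 2 * s + 6 * (e * s) + 1"
      using boxicity_le_large_degree_add[OF assms(1-3), of d] S
      unfolding L_def e_def by linarith
    also have "\<dots> \<le> 15 * (e * s) + s" using s es by linarith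
    finally show ?thesis by (simp add: algebra_simps)
  next
    case False
    have "m \<le> s"
      unfolding s_def using False
      by (intro real_le_rsqrt) (simp add: power2_eq_square mult_left_mono)
    moreover have "card {v \<in> V. card {e \<in> E. v \<in> e} > 0} \<le> 2 * m"
      using card_large_degree[OF assms(1), of 0] assms(4) by simp
    ultimately have "boxicity V E \<le> 2 * s + 1"
      using boxicity_le_non_isolated[OF assms(1)] by linarith
    also have "\<dots> \<le> 15 * (e * s) + s" using s es by linarith
    finally show ?thesis by (simp add: algebra_simps)
  qed
  then show ?thesis by (simp add: s_def L_def e_def)
qed

end
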